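(* Let $n$ be a positive integer with $\gcd(n,6)=1$, and let $S=(x_1)(x_2)(x_3)(x_4)$ be a minimal zero-sum sequence over $\mathbb{Z}/n$, where the $x_i$ are integers with $1\le x_i<n$. Suppose $S$ is singular, i.e.: (i) $x_1=1$; (ii) $x_2+1=x_3$ or $x_2=n-2$; (iii) $\gcd(x_i,n)=1$ for all $i=1,\dots,4$. Then $\mathrm{ind}(S)=1$.
   Context: A sequence $(a_1)\cdots(a_k)$ over $\mathbb{Z}/n$ is zero-sum if $\sum a_i=0$, and minimal zero-sum if it is zero-sum and no proper nontrivial subsequence is zero-sum. For a generator $g$ of $\mathbb{Z}/n$, write $S=(y_1g)\cdots(y_kg)$ with integers $1\le y_i\le n$ and define the $g$-norm $\|S\|_g=\frac{1}{n}\sum_{i=1}^k y_i$. The index of $S$ is $\mathrm{ind}(S)=\min_g \|S\|_g$, the minimum over all generators $g$ of $\mathbb{Z}/n$. *)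

theory Defs
  imports Complex_Main "HOL-Algebra.Elementary_Groups" "HOL-Number_Theory.Cong" "HOL-Library.Multiset"
begin

text \<open>
  A sequence over \<open>\<int>/n\<close> is unordered, with repetition, so it is a multiset. Its terms are given by
  integer representatives; the definitions below depend on them only modulo \<open>n\<close>.
\<close>

definition zero_sum :: "nat \<Rightarrow> int multiset \<Rightarrow> bool" where
  "zero_sum n S \<longleftrightarrow> [(\<Sum>a\<in>#S. a) = 0] (mod int n)"

definition minimal_zero_sum :: "nat \<Rightarrow> int multiset \<Rightarrow> bool" where
  "minimal_zero_sum n S \<longleftrightarrow>
     zero_sum n S \<and> (\<forall>T. T \<subset># S \<and> T \<noteq> {#} \<longrightarrow> \<not> zero_sum n T)"

definition generators :: "nat \<Rightarrow> int set" where
  "generators n = {g \<in> carrier (integer_mod_group n).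
     subgroup_generated (integer_mod_group n) {g} = integer_mod_group n}"

definition gen_coeff :: "nat \<Rightarrow> int \<Rightarrow> int \<Rightarrow> nat" where
  "gen_coeff n g a = (THE y. 1 \<le> y \<and> y \<le> n \<and> [int y * g = a] (mod int n))"

definition g_norm :: "nat \<Rightarrow> int \<Rightarrow> int multiset \<Rightarrow> real" where
  "g_norm n g S = (\<Sum>a\<in>#S. real (gen_coeff n g a)) / real n"

definition seq_index :: "nat \<Rightarrow> int multiset \<Rightarrow> real" where
  "seq_index n S = Min ((\<lambda>g. g_norm n g S) ` generators n)"

text \<open>The description operator and the minimum above are well defined for every \<open>n \<ge> 1\<close>.\<close>

lemma gen_coeff_ex1:
  assumes n: "n \<ge> 1" and g: "g \<in> generators n"
  shows "\<exists>!y. 1 \<le> y \<and> y \<le> n \<and> [int y * g = a] (mod int n)"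
proof -
  interpret group "integer_mod_group n" by simp
  have gc: "g \<in> carrier (integer_mod_group n)"
    and gen: "subgroup_generated (integer_mod_group n) {g} = integer_mod_group n"
    using g by (auto simp: generators_def)
  have range: "range (\<lambda>k::int. (k * g) mod int n) = {0..<int n}"
    using carrier_subgroup_generated_by_singleton[OF gc] n
    by (simp add: gen int_pow_integer_mod_group carrier_integer_mod_group)
  have ex: "\<exists>k. [k * g = b] (mod int n)" for b
  proof -
    have "b mod int n \<in> range (\<lambda>k::int. (k * g) mod int n)"
      unfolding range using n by auto
    then show ?thesis by (auto simp: cong_def)
  qed
  obtain u where "[u * g = 1] (mod int n)" using ex by blast
  then have cop: "coprime g (int n)"
    by (metis cong_solve_coprime_int coprime_iff_invertible_int mult.commute)
  obtain k where k: "[k * g = a] (mod int n)" using ex by blast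
  define y where "y = nat ((k - 1) mod int n) + 1"
  have "int y = (k - 1) mod int n + 1" using n by (simp add: y_def)
  then have "[int y = k] (mod int n)"
    by (simp add: cong_def mod_simps)
  then have "[int y * g = a] (mod int n)"
    using k by (meson cong_scalar_right cong_trans)
  moreover have "nat ((k - 1) mod int n) < n"
    using n by (simp add: nat_less_iff)
  then have "1 \<le> y" "y \<le> n" by (auto simp: y_def)
  moreover have "y' = z"
    if "1 \<le> y'" "y' \<le> n" "[int y' * g = a] (mod int n)"
       "1 \<le> z" "z \<le> n" "[int z * g = a] (mod int n)" for y' z
  proof -
    have "[int y' * g = int z * g] (mod int n)"
      using that by (meson cong_sym cong_trans)
    then have "[int y' = int z] (mod int n)"
      using cop by (simp add: cong_mult_rcancel)
    then have "int n dvd int y' - int z"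
      by (simp add: cong_iff_dvd_diff)
    moreover have "\<bar>int y' - int z\<bar> < int n"
      using that by linarith
    ultimately have "int y' - int z = 0"
      by (metis dvd_imp_le_int abs_of_nat not_le)
    then show ?thesis by simp
  qed
  ultimately show ?thesis by blast
qed

lemma finite_generators: "n \<ge> 1 \<Longrightarrow> finite (generators n)"
  by (rule finite_subset[of _ "{0..<int n}"])
    (auto simp: generators_def carrier_integer_mod_group)

lemma generators_nonempty:
  assumes n: "n \<ge> 1"
  shows "generators n \<noteq> {}"
proof -
  interpret group "integer_mod_group n" by simp
  have gc: "1 mod int n \<in> carrier (integer_mod_group n)"
    using n by (simp add: carrier_integer_mod_group)
  have "range (\<lambda>k::int. k mod int n) = {0..<int n}"
  proof
    show "{0..<int n} \<subseteq> range (\<lambda>k::int. k mod int n)"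
    proof
      fix k assume "k \<in> {0..<int n}"
      then have "k = k mod int n" by simp
      then show "k \<in> range (\<lambda>k::int. k mod int n)" by (rule range_eqI)
    qed
  qed (use n in auto)
  then have "carrier (subgroup_generated (integer_mod_group n) {1 mod int n})
      = carrier (integer_mod_group n)"
    using carrier_subgroup_generated_by_singleton[OF gc] n
    by (simp add: int_pow_integer_mod_group carrier_integer_mod_group mod_simps)
  then have "1 mod int n \<in> generators n"
    using gc by (simp add: generators_def subgroup_generated_def)
  then show ?thesis by blast
qed

end

theory Submission
  imports Defs
begin

text \<open>
  Up to a unit factor the sequence is \<open>(1)(-2)(c)(1 - c)\<close>, with \<open>c\<close> not congruent to \<open>2\<close> or \<open>-1\<close>
  by minimality. If no unit multiple has norm \<open>1\<close>, then replacing \<open>m\<close> by \<open>-m\<close> shows that all norms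
  are \<open>2\<close>, that is, \<open>R m - R (2 m) + R (c m) - R ((c - 1) m) = 0\<close> for all units \<open>m\<close>, where \<open>R\<close> is
  the least residue. Comparing the sum of squares of this combination with that of its adjoint
  gives \<open>R m - R (m / 2) + R (m / c) - R (m / (c - 1)) = 0\<close> as well, and \<open>m = 2\<close> yields
  \<open>c (c - 1) = 2\<close> modulo \<open>n\<close>. Hence \<open>n = p q\<close> with \<open>p\<close> and \<open>q\<close> coprime and nontrivial, where \<open>c\<close> is
  \<open>2\<close> modulo \<open>p\<close> and \<open>-1\<close> modulo \<open>q\<close>. The symmetry \<open>c \<mapsto> 1 - c\<close> allows to assume \<open>p < q\<close>. Two
  consecutive powers of \<open>2\<close> lie between \<open>q / (2 p)\<close> and \<open>2 q / p\<close>; for one of them, \<open>w\<close>, the number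
  \<open>m = (q + p w) / 3\<close> is an integer, and it is a unit whose four residues \<open>m\<close>, \<open>n - 2 m\<close>, \<open>q - m\<close>,
  \<open>2 m - q\<close> add up to \<open>n\<close>.
\<close>

section \<open>Dilations of functions on the units modulo \<open>n\<close>\<close>

definition int_units :: "int \<Rightarrow> int set" where
  "int_units n = {x \<in> {0..<n}. coprime x n}"

lemma finite_int_units [simp]: "finite (int_units n)"
  by (rule finite_subset[of _ "{0..<n}"]) (auto simp: int_units_def)

lemma sum_int_units_scale:
  assumes "n > 0" "coprime a n"
  shows "(\<Sum>x\<in>int_units n. f (a * x mod n)) = (\<Sum>x\<in>int_units n. f x)"
proof -
  have inj: "inj_on (\<lambda>x. a * x mod n) (int_units n)"
  proof (rule inj_onI)
    fix x y assume xy: "x \<in> int_units n" "y \<in> int_units n" "a * x mod n = a * y mod n"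
    then have "[x = y] (mod n)"
      using cong_mult_lcancel[OF assms(2), of x y] by (simp add: cong_def)
    then show "x = y" using xy by (simp add: int_units_def cong_def)
  qed
  have "(\<lambda>x. a * x mod n) ` int_units n \<subseteq> int_units n"
    using assms by (auto simp: int_units_def)
  then have "bij_betw (\<lambda>x. a * x mod n) (int_units n) (int_units n)"
    using inj by (simp add: bij_betw_def endo_inj_surj)
  then show ?thesis by (rule sum.reindex_bij_betw)
qed

text \<open>
  Convolution operators on the unit group are normal: the adjoint replaces every dilation by
  its inverse, so an operator and its adjoint have the same norm on each function.
\<close>

lemma sum_squares_dilations_inverse:
  fixes f :: "int \<Rightarrow> 'a::comm_ring_1"
  assumes n: "n > 0" and fin: "finite I" and inv: "\<And>i. i \<in> I \<Longrightarrow> [a i * b i = 1] (mod n)"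
  shows "(\<Sum>x\<in>int_units n. (\<Sum>i\<in>I. w i * f (a i * x mod n))\<^sup>2)
       = (\<Sum>x\<in>int_units n. (\<Sum>i\<in>I. w i * f (b i * x mod n))\<^sup>2)"
proof -
  have expand: "(\<Sum>x\<in>int_units n. (\<Sum>i\<in>I. w i * f (e i * x mod n))\<^sup>2)
     = (\<Sum>i\<in>I. \<Sum>j\<in>I. w i * w j * (\<Sum>x\<in>int_units n. f (e i * x mod n) * f (e j * x mod n)))"
    for e :: "_ \<Rightarrow> int"
  proof -
    have "(\<Sum>x\<in>int_units n. (\<Sum>i\<in>I. w i * f (e i * x mod n))\<^sup>2)
      = (\<Sum>x\<in>int_units n. \<Sum>i\<in>I. \<Sum>j\<in>I. w i * w j * (f (e i * x mod n) * f (e j * x mod n)))"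
      by (simp add: power2_eq_square sum_product mult_ac)
    also have "\<dots> = (\<Sum>i\<in>I. \<Sum>x\<in>int_units n. \<Sum>j\<in>I.
        w i * w j * (f (e i * x mod n) * f (e j * x mod n)))"
      by (rule sum.swap)
    also have "\<dots> = (\<Sum>i\<in>I. \<Sum>j\<in>I. \<Sum>x\<in>int_units n.
        w i * w j * (f (e i * x mod n) * f (e j * x mod n)))"
      by (intro sum.cong refl sum.swap)
    finally show ?thesis by (simp add: sum_distrib_left)
  qed
  have swap: "(\<Sum>x\<in>int_units n. f (a i * x mod n) * f (a j * x mod n))
      = (\<Sum>x\<in>int_units n. f (b i * x mod n) * f (b j * x mod n))"
    if ij: "i \<in> I" "j \<in> I" for i j
  proof -
    \<comment> \<open>The substitution of \<open>a i * a j * x\<close> for \<open>x\<close> turns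
      \<open>b i * x\<close> into \<open>a j * x\<close> and \<open>b j * x\<close> into
      \<open>a i * x\<close>, so each correlation is preserved up to order of factors.\<close>
    have cop: "coprime (a i * a j) n"
      using inv[OF ij(1)] inv[OF ij(2)] unfolding coprime_mult_left_iff
      by (auto simp: coprime_iff_invertible_int)
    have cancel: "b k * (a k * y mod n) mod n = y mod n" if "k \<in> I" for k y
    proof -
      have "[(a k * b k) * y = 1 * y] (mod n)" using inv[OF that] by (rule cong_scalar_right)
      then show ?thesis by (simp add: cong_def mod_simps mult_ac)
    qed
    have "b i * (a i * a j * x mod n) mod n = a j * x mod n" for x
      using cancel[OF ij(1), of "a j * x"] by (simp add: mult_ac)
    moreover have "b j * (a i * a j * x mod n) mod n = a i * x mod n" for x
      using cancel[OF ij(2), of "a i * x"] by (simp add: mult_ac)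
    ultimately show ?thesis
      using sum_int_units_scale[OF n cop, of "\<lambda>x. f (b i * x mod n) * f (b j * x mod n)"]
      by (simp add: mult.commute)
  qed
  show ?thesis unfolding expand by (intro sum.cong refl) (simp add: swap)
qed

text \<open>Over the integers a vanishing sum of squares forces every term to vanish, so equality of
  norms makes the kernels of an operator and its adjoint agree.\<close>

lemma dilation_combination_zero_inverse:
  fixes f :: "int \<Rightarrow> int"
  assumes "n > 0" "finite I" "\<And>i. i \<in> I \<Longrightarrow> [a i * b i = 1] (mod n)"
    and zero: "\<And>x. x \<in> int_units n \<Longrightarrow> (\<Sum>i\<in>I. w i * f (a i * x mod n)) = 0"
    and x: "x \<in> int_units n"
  shows "(\<Sum>i\<in>I. w i * f (b i * x mod n)) = 0"
proof -
  have "(\<Sum>x\<in>int_units n. (\<Sum>i\<in>I. w i * f (b i * x mod n))\<^sup>2) = 0"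
    using sum_squares_dilations_inverse[of n I a b w f] assms(1-3) zero by simp
  then show ?thesis using x by (simp add: sum_nonneg_eq_0_iff)
qed

section \<open>Residues of unit multiples of \<open>(1)(-2)(c)(1 - c)\<close>\<close>

definition residue_sum :: "int \<Rightarrow> int \<Rightarrow> int \<Rightarrow> int" where
  "residue_sum n c m = m mod n + (- 2 * m) mod n + (m * c) mod n + (m * (1 - c)) mod n"

lemma residue_sum_swap: "residue_sum n (1 - c) m = residue_sum n c m"
  by (simp add: residue_sum_def)

lemma mod_uminus_of_coprime:
  fixes n a :: int
  assumes "n > 1" "coprime a n"
  shows "(- a) mod n = n - a mod n"
proof -
  have "\<not> n dvd a" using assms coprime_common_divisor[of a n n] by auto
  then show ?thesis by (simp add: zmod_zminus1_eq_if dvd_eq_mod_eq_0)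
qed

text \<open>The left-hand side \<open>T\<close> is a multiple of \<open>n\<close> with absolute
  value below \<open>2 * n\<close>. The residue sums at \<open>m\<close> and \<open>- m\<close> are
  \<open>2 * n + T\<close> and \<open>2 * n - T\<close>; neither is \<open>n\<close>, so only
  \<open>T = 0\<close> remains.\<close>

lemma residue_sum_balanced:
  fixes n c m :: int
  assumes n: "n > 1" and cop: "coprime 2 n" "coprime c n" "coprime (c - 1) n" "coprime m n"
    and ne: "\<And>k. coprime k n \<Longrightarrow> residue_sum n c k \<noteq> n"
  shows "m mod n - (2 * m) mod n + (c * m) mod n - ((c - 1) * m) mod n = 0"
proof -
  define T where "T = m mod n - (2 * m) mod n + (c * m) mod n - ((c - 1) * m) mod n"
  have neg: "(- (2 * m)) mod n = n - (2 * m) mod n" "(- ((c - 1) * m)) mod n = n - ((c - 1) * m) mod n"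
    "(- m) mod n = n - m mod n" "(- (c * m)) mod n = n - (c * m) mod n"
    using n cop by (auto intro!: mod_uminus_of_coprime)
  have eqs: "m * c = c * m" "m * (1 - c) = - ((c - 1) * m)" "- m * c = - (c * m)"
     "- m * (1 - c) = (c - 1) * m" "- 2 * m = - (2 * m)" "- 2 * - m = 2 * m"
    by (auto simp: algebra_simps)
  have plus: "residue_sum n c m = 2 * n + T" and minus: "residue_sum n c (- m) = 2 * n - T"
    unfolding residue_sum_def eqs neg T_def by auto
  have "[T = m - 2 * m + c * m - (c - 1) * m] (mod n)"
    unfolding T_def by (intro cong_add cong_diff) (simp_all add: cong_def)
  then have dvd: "n dvd T" by (simp add: algebra_simps cong_0_iff)
  have pos: "0 < k mod n" "k mod n < n" if "coprime k n" for k
    using mod_uminus_of_coprime[OF n that] pos_mod_bound[of n "- k"] pos_mod_bound[of n k] n by auto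
  have "coprime (2 * m) n" "coprime (c * m) n" "coprime ((c - 1) * m) n"
    using cop by auto
  then have "\<bar>T\<bar> < 2 * n"
    using pos[of m] pos[of "2 * m"] pos[of "c * m"] pos[of "(c - 1) * m"] cop(4)
    unfolding T_def by linarith
  moreover have "T \<noteq> n" "T \<noteq> - n"
    using ne[of m] ne[of "- m"] cop plus minus by auto
  moreover obtain k where k: "T = n * k" using dvd by (rule dvdE)
  ultimately have "\<bar>k\<bar> < 2" "k \<noteq> 1" "k \<noteq> -1"
    using n by (auto simp: abs_mult)
  then have "k = 0" by linarith
  then show ?thesis using k by (simp add: T_def)
qed

lemma cong_2_of_balanced:
  fixes n c :: int
  assumes n: "n > 1" and cop: "coprime 2 n" "coprime c n" "coprime (c - 1) n"
    and bal: "\<And>m. coprime m n \<Longrightarrow>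
      m mod n - (2 * m) mod n + (c * m) mod n - ((c - 1) * m) mod n = 0"
  shows "[c * (c - 1) = 2] (mod n)"
proof -
  obtain h where h: "[2 * h = 1] (mod n)" using cop(1) by (auto simp: coprime_iff_invertible_int)
  obtain c' where c': "[c * c' = 1] (mod n)" using cop(2) by (auto simp: coprime_iff_invertible_int)
  obtain d' where d': "[(c - 1) * d' = 1] (mod n)" using cop(3) by (auto simp: coprime_iff_invertible_int)
  define a where "a = (\<lambda>i::nat. [1, 2, c, c - 1] ! i)"
  define b where "b = (\<lambda>i::nat. [1, h, c', d'] ! i)"
  define w where "w = (\<lambda>i::nat. [1, -1, 1, -1 :: int] ! i)"
  have "odd n" using cop(1) by simp
  then have n2: "n > 2" using n by (cases "n = 2") auto
  \<comment> \<open>The adjoint relation is evaluated at \<open>2\<close> because two of its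
    residues are then known: \<open>2\<close> itself and \<open>h * 2\<close>, which reduces to
    \<open>1\<close>.\<close>
  have "(\<Sum>i<4. w i * (b i * 2 mod n)) = 0"
  proof (rule dilation_combination_zero_inverse[where n = n and a = a and f = "\<lambda>x. x"])
    show "[a i * b i = 1] (mod n)" if "i \<in> {..<4}" for i
    proof -
      have "i = 0 \<or> i = 1 \<or> i = 2 \<or> i = 3" using that by auto
      then show ?thesis using h c' d' by (auto simp: a_def b_def)
    qed
    show "(\<Sum>i<4. w i * (a i * x mod n)) = 0" if "x \<in> int_units n" for x
      using bal[of x] that by (simp add: int_units_def a_def w_def eval_nat_numeral)
  qed (use n n2 cop in \<open>auto simp: int_units_def\<close>)
  then have "2 mod n - (h * 2) mod n + (c' * 2) mod n - (d' * 2) mod n = 0"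
    by (simp add: b_def w_def eval_nat_numeral)
  moreover have "(h * 2) mod n = 1" using h n by (simp add: cong_def mult.commute)
  ultimately have eq: "(d' * 2) mod n = 1 + (c' * 2) mod n" using n2 by simp
  \<comment> \<open>This reads \<open>2 / (c - 1) = 1 + 2 / c\<close>; multiplication by
    \<open>c * (c - 1)\<close> clears the denominators.\<close>
  have "[d' * 2 = 1 + c' * 2] (mod n)"
    using eq n by (metis cong_def mod_add_right_eq mod_mod_trivial)
  then have "[c * (c - 1) * (d' * 2) = c * (c - 1) * (1 + c' * 2)] (mod n)"
    by (rule cong_scalar_left)
  moreover have "[2 * c * ((c - 1) * d') = 2 * c * 1] (mod n)"
    using d' by (rule cong_scalar_left)
  moreover have "[c * (c - 1) + 2 * (c - 1) * (c * c') = c * (c - 1) + 2 * (c - 1) * 1] (mod n)"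
    using c' by (intro cong_add cong_scalar_left cong_refl)
  ultimately have "[2 * c = c * (c - 1) + 2 * (c - 1)] (mod n)"
    by (simp add: cong_def algebra_simps)
  then show ?thesis by (simp add: cong_iff_dvd_diff algebra_simps dvd_diff_commute)
qed

section \<open>Explicit multiplier when \<open>c\<close> is \<open>2\<close> modulo \<open>p\<close>
  and \<open>-1\<close> modulo \<open>q\<close>\<close>

lemma ex_power_of_two_between:
  fixes p q :: int
  assumes "0 < p" "p < q" "odd q"
  shows "\<exists>i::nat. q < 2 * p * 2 ^ i \<and> 2 * p * 2 ^ i < 2 * q"
proof -
  have "q < 2 * p * 2 ^ nat q"
  proof -
    have "q < 2 ^ nat q" using of_nat_less_two_power[of "nat q", where 'a = int] assms by simp
    also have "\<dots> \<le> 2 * p * 2 ^ nat q" using assms by simp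
    finally show ?thesis .
  qed
  then obtain i where i: "q < 2 * p * 2 ^ i" "\<And>j. j < i \<Longrightarrow> \<not> q < 2 * p * 2 ^ j"
    using exists_least_iff[of "\<lambda>i. q < 2 * p * 2 ^ i"] by blast
  \<comment> \<open>By minimality of \<open>i\<close> the preceding power gives at most
    \<open>q\<close>, and equality is impossible for odd \<open>q\<close>; for \<open>i = 0\<close>
    the bound is \<open>p < q\<close>.\<close>
  have "2 * p * 2 ^ i < 2 * q"
  proof (cases i)
    case (Suc j)
    then have "2 * p * 2 ^ j \<le> q" using i(2)[of j] by simp
    moreover have "q \<noteq> 2 * p * 2 ^ j" using assms(3) by auto
    ultimately show ?thesis using Suc by simp
  qed (use assms in auto)
  then show ?thesis using i by blast
qed

lemma residue_sum_eq_of_split: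
  fixes p q c :: int
  assumes p: "1 < p" and pq: "p < q" "coprime p q" and cop: "coprime (p * q) 6"
    and c: "p dvd c - 2" "q dvd c + 1"
  shows "\<exists>m. coprime m (p * q) \<and> residue_sum (p * q) c m = p * q"
proof -
  have cop': "coprime p 3" "coprime q 3" "coprime q 2"
    using cop by (auto intro: coprime_divisors[of _ "p * q" _ 6])
  then have "odd q" by simp
  then obtain i where i: "q < 2 * p * 2 ^ i" "2 * p * 2 ^ i < 2 * q"
    using ex_power_of_two_between[of p q] p pq by auto
  have "\<exists>w. coprime w q \<and> 3 dvd q + p * w \<and> q < 2 * p * w \<and> p * w < 2 * q"
  proof -
    have copq: "coprime (2 ^ k) q" for k using cop' by (simp add: coprime_commute)
    have nd: "\<not> 3 dvd q" "\<not> 3 dvd p * 2 ^ i"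
    proof -
      have *: "\<not> 3 dvd x" if "coprime x 3" for x :: int
        using that coprime_common_divisor[of x 3 3] by auto
      show "\<not> 3 dvd q" using cop' by (intro *)
      show "\<not> 3 dvd p * 2 ^ i" by (intro *) (use cop' in auto)
    qed
    \<comment> \<open>Both \<open>q\<close> and \<open>p * 2 ^ i\<close> are nonzero modulo
      \<open>3\<close>, and doubling flips the sign there. Either exponent, \<open>i\<close> or
      \<open>Suc i\<close>, respects the bounds on \<open>w\<close>.\<close>
    then have "3 dvd q + p * 2 ^ i \<or> 3 dvd q + 2 * (p * 2 ^ i)" by presburger
    then show ?thesis
    proof
      assume "3 dvd q + p * 2 ^ i"
      then show ?thesis using i copq[of i] p pq by (intro exI[of _ "2 ^ i"]) auto
    next
      assume "3 dvd q + 2 * (p * 2 ^ i)"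
      then show ?thesis using i copq[of "Suc i"] p pq
        by (intro exI[of _ "2 ^ Suc i"]) (auto simp: mult_ac)
    qed
  qed
  then obtain w where w: "coprime w q" "3 dvd q + p * w" "q < 2 * p * w" "p * w < 2 * q" by blast
  then obtain m where m: "q + p * w = 3 * m" by blast
  \<comment> \<open>The bounds on \<open>w\<close> were chosen for this: they make
    \<open>q - m\<close> and \<open>2 * m - q\<close> positive, hence least residues.\<close>
  have ineq: "m < q" "q < 2 * m" using w m by auto
  have n: "2 * q \<le> p * q" using p pq by simp
  have "coprime (q + p * w) p"
    using pq(2) gcd_add_mult[of p w q] by (simp add: coprime_iff_gcd_eq_1 gcd.commute add.commute mult.commute)
  moreover have "coprime (q + p * w) q"
    using pq(2) w(1) gcd_add_mult[of q 1 "p * w"]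
    by (metis add.commute coprime_iff_gcd_eq_1 coprime_mult_left_iff gcd.commute mult_1)
  ultimately have "coprime (3 * m) (p * q)" using m by simp
  then have mcop: "coprime m (p * q)" by simp
  \<comment> \<open>Modulo \<open>p\<close>, \<open>c + 1\<close> is \<open>3\<close> and
    \<open>3 * m\<close> is \<open>q\<close>; modulo \<open>q\<close>, both terms vanish.\<close>
  have "p * q dvd m * (c + 1) - q"
  proof (rule divides_mult)
    have "3 * (m * (c + 1) - q) = (q + p * w) * (c + 1) - 3 * q"
      unfolding m by (simp add: algebra_simps)
    also have "\<dots> = q * (c - 2) + p * (w * (c + 1))" by (simp add: algebra_simps)
    finally have "p dvd 3 * (m * (c + 1) - q)" using c by simp
    then show "p dvd m * (c + 1) - q" using coprime_dvd_mult_right_iff[OF cop'(1)] by blast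
    show "q dvd m * (c + 1) - q" using c by simp
  qed (use pq in simp)
  then have d: "p * q dvd m * c - (q - m)" by (simp add: algebra_simps)
  have d': "p * q dvd m * (1 - c) - (2 * m - q)"
    using d by (subst (asm) dvd_minus_iff[symmetric]) (simp add: algebra_simps)
  have modI: "x mod (p * q) = y" if "p * q dvd x - y" "0 \<le> y" "y < p * q" for x y
    using that by (metis mod_eq_dvd_iff mod_pos_pos_trivial)
  have bounds: "0 < m" "m < p * q" "0 \<le> p * q - 2 * m" "q - m < p * q" "2 * m - q < p * q"
    using ineq n by linarith+
  have "m mod (p * q) = m" using bounds by (intro modI) auto
  moreover have "(- 2 * m) mod (p * q) = p * q - 2 * m" using bounds by (intro modI) auto
  moreover have "(m * c) mod (p * q) = q - m" using d ineq bounds by (intro modI) auto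
  moreover have "(m * (1 - c)) mod (p * q) = 2 * m - q" using d' ineq bounds by (intro modI) auto
  ultimately show ?thesis using mcop by (auto simp: residue_sum_def)
qed

lemma ex_residue_sum_eq:
  fixes n c :: int
  assumes n: "n > 1" and cop: "coprime n 6" "coprime c n" "coprime (c - 1) n"
    and c: "\<not> [c = 2] (mod n)" "\<not> [c = - 1] (mod n)"
  shows "\<exists>m. coprime m n \<and> residue_sum n c m = n"
proof (rule ccontr)
  assume contra: "\<nexists>m. coprime m n \<and> residue_sum n c m = n"
  have cop2: "coprime 2 n"
    using coprime_divisors[of 2 6 n n] cop(1) by (simp add: coprime_commute)
  have "[c * (c - 1) = 2] (mod n)"
    using contra n cop cop2 by (intro cong_2_of_balanced residue_sum_balanced) auto
  then have "n dvd (c - 2) * (c + 1)"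
    by (simp add: cong_iff_dvd_diff algebra_simps)
  then obtain p0 q0 where pq0: "n = p0 * q0" "p0 dvd c - 2" "q0 dvd c + 1"
    using division_decomp by blast
  define p q where "p = \<bar>p0\<bar>" and "q = \<bar>q0\<bar>"
  have pq: "n = p * q" "p dvd c - 2" "q dvd c + 1" "p \<ge> 0" "q \<ge> 0"
    using pq0 n by (auto simp: p_def q_def simp flip: abs_mult)
  \<comment> \<open>If one factor were \<open>1\<close>, the other would be \<open>n\<close>, making
    \<open>c\<close> congruent to \<open>-1\<close> or \<open>2\<close>.\<close>
  have "p \<noteq> 0" "q \<noteq> 0" "p \<noteq> 1" "q \<noteq> 1"
    using pq c n by (auto simp: cong_iff_dvd_diff)
  then have gt: "p > 1" "q > 1" using pq by linarith+
  have copq: "coprime p q"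
  proof (rule coprimeI)
    fix d assume d: "d dvd p" "d dvd q"
    then have "d dvd c + 1" "d dvd c - 2" using pq dvd_trans by metis+
    then have "d dvd (c + 1) - (c - 2)" by (rule dvd_diff)
    then have "d dvd 6" using dvd_trans[of d 3 6] by simp
    moreover have "d dvd n" using d pq by simp
    ultimately show "is_unit d" using cop(1) coprime_common_divisor by blast
  qed
  consider "p < q" | "q < p" using copq gt by (cases p q rule: linorder_cases) auto
  then show False
  proof cases
    case 1
    then show False using residue_sum_eq_of_split[of p q c] contra gt pq copq cop by auto
  next
    case 2
    \<comment> \<open>The map \<open>c\<close> to \<open>1 - c\<close> exchanges \<open>2\<close>
      and \<open>-1\<close>, so \<open>p\<close> and \<open>q\<close> trade roles.\<close>
    have "q dvd (1 - c) - 2" "p dvd (1 - c) + 1"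
      using pq dvd_minus_iff[of q "c + 1"] dvd_minus_iff[of p "c - 2"] by (simp_all add: algebra_simps)
    then have "\<exists>m. coprime m (q * p) \<and> residue_sum (q * p) (1 - c) m = q * p"
      using 2 gt copq cop pq by (intro residue_sum_eq_of_split) (auto simp: coprime_commute mult.commute)
    then show False using contra pq by (auto simp: residue_sum_swap mult.commute)
  qed
qed

section \<open>Generators, norms and the index\<close>

lemma coprime_in_generators:
  assumes n: "n \<ge> 1" and g: "g \<in> {0..<int n}" "coprime g (int n)"
  shows "g \<in> generators n"
proof -
  interpret group "integer_mod_group n" by simp
  have gc: "g \<in> carrier (integer_mod_group n)"
    using n g by (simp add: carrier_integer_mod_group)
  obtain h where h: "[g * h = 1] (mod int n)"
    using g by (auto simp: coprime_iff_invertible_int)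
  have "range (\<lambda>k::int. (k * g) mod int n) = {0..<int n}"
  proof
    show "{0..<int n} \<subseteq> range (\<lambda>k::int. (k * g) mod int n)"
    proof
      fix k assume k: "k \<in> {0..<int n}"
      have "[k * (g * h) = k * 1] (mod int n)" using h by (rule cong_scalar_left)
      then have "k = (k * h * g) mod int n" using k by (simp add: cong_def mult_ac)
      then show "k \<in> range (\<lambda>k::int. (k * g) mod int n)" by (rule range_eqI)
    qed
  qed (use n in auto)
  then have "carrier (subgroup_generated (integer_mod_group n) {g}) = carrier (integer_mod_group n)"
    using carrier_subgroup_generated_by_singleton[OF gc] n
    by (simp add: int_pow_integer_mod_group carrier_integer_mod_group)
  then show ?thesis using gc by (simp add: generators_def subgroup_generated_def)
qed

lemma gen_coeff_props:
  assumes "n \<ge> 1" "g \<in> generators n"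
  shows "1 \<le> gen_coeff n g a" "[int (gen_coeff n g a) * g = a] (mod int n)"
  using theI'[OF gen_coeff_ex1[OF assms, of a]] by (auto simp: gen_coeff_def)

text \<open>Coefficients with respect to \<open>g\<close> arise from multiplication by its inverse
  \<open>t\<close>. A multiple of \<open>n\<close> is excluded since its coefficient is
  \<open>n\<close> while its residue is \<open>0\<close>.\<close>

lemma gen_coeff_eq_mod:
  assumes n: "n \<ge> 1" and g: "g \<in> generators n" and t: "[t * g = 1] (mod int n)"
    and a: "\<not> int n dvd t * a"
  shows "int (gen_coeff n g a) = (t * a) mod int n"
proof -
  define y where "y = nat ((t * a) mod int n)"
  have y: "int y = (t * a) mod int n" using n by (simp add: y_def)
  have "(t * a) mod int n \<noteq> 0" "0 \<le> (t * a) mod int n" "(t * a) mod int n < int n"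
    using a n by (simp_all add: dvd_eq_mod_eq_0)
  then have "1 \<le> y" "y \<le> n" using y by linarith+
  moreover have "[int y * g = a] (mod int n)"
  proof -
    have "[a * (t * g) = a * 1] (mod int n)" using t by (rule cong_scalar_left)
    then show ?thesis by (simp add: y cong_def mod_simps mult_ac)
  qed
  ultimately have "gen_coeff n g a = y"
    unfolding gen_coeff_def by (intro the1_equality[OF gen_coeff_ex1[OF n g]]) blast
  then show ?thesis using y by simp
qed

text \<open>The coefficient sum times \<open>g\<close> is zero modulo \<open>n\<close> and
  \<open>g\<close> is invertible, so this positive sum is a multiple of \<open>n\<close>.\<close>

lemma g_norm_ge_1:
  assumes n: "n \<ge> 1" and g: "g \<in> generators n" and S: "zero_sum n S" "S \<noteq> {#}"
  shows "g_norm n g S \<ge> 1"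
proof -
  define Y where "Y = (\<Sum>a\<in>#S. gen_coeff n g a)"
  have "[(\<Sum>a\<in>#T. int (gen_coeff n g a)) * g = (\<Sum>a\<in>#T. a)] (mod int n)" for T
    by (induction T) (auto simp: distrib_right intro!: cong_add gen_coeff_props[OF n g])
  then have "[int Y * g = 0] (mod int n)"
    using S(1) unfolding zero_sum_def Y_def by (metis (no_types, lifting) cong_trans of_nat_sum_mset image_mset.compositionality comp_def image_mset_cong)
  \<comment> \<open>The coefficient of \<open>1\<close> is an inverse of \<open>g\<close>.\<close>
  moreover obtain t where t: "[int t * g = 1] (mod int n)"
    using gen_coeff_props[OF n g, of 1] by blast
  ultimately have "[int Y = 0] (mod int n)"
  proof -
    have "[int Y * (int t * g) = int Y * 1] (mod int n)" using t by (rule cong_scalar_left)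
    moreover have "[int t * (int Y * g) = int t * 0] (mod int n)"
      using \<open>[int Y * g = 0] (mod int n)\<close> by (rule cong_scalar_left)
    ultimately show ?thesis by (simp add: cong_def mult_ac)
  qed
  then have "n dvd Y" by (simp add: cong_0_iff)
  moreover have "Y > 0"
  proof -
    obtain a where "a \<in># S" using S(2) by blast
    then have "gen_coeff n g a \<le> Y" unfolding Y_def by (metis insert_DiffM image_mset_add_mset sum_mset.insert le_add1)
    then show ?thesis using gen_coeff_props(1)[OF n g, of a] by linarith
  qed
  ultimately have "n \<le> Y" by (simp add: dvd_imp_le)
  moreover have "g_norm n g S = real Y / real n"
    unfolding g_norm_def Y_def by (simp add: of_nat_sum_mset image_mset.compositionality comp_def)
  ultimately show ?thesis using n by simp
qed

text \<open>No norm is below \<open>1\<close>, so one generator of norm \<open>1\<close> suffices;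
  the inverse of \<open>t\<close> is one.\<close>

lemma seq_index_eq_1I:
  assumes n: "n \<ge> 1" and S: "zero_sum n S" "S \<noteq> {#}" and t: "coprime t (int n)"
    and nz: "\<And>a. a \<in># S \<Longrightarrow> \<not> int n dvd t * a"
    and sum: "(\<Sum>a\<in>#S. (t * a) mod int n) = int n"
  shows "seq_index n S = 1"
proof -
  obtain h where h: "[t * h = 1] (mod int n)"
    using t by (auto simp: coprime_iff_invertible_int)
  define g where "g = h mod int n"
  have tg: "[t * g = 1] (mod int n)" using h by (simp add: g_def cong_def mod_simps)
  then have "coprime g (int n)"
    by (metis coprime_iff_invertible_int mult.commute)
  then have g: "g \<in> generators n" using n by (intro coprime_in_generators) (auto simp: g_def)
  have "(\<Sum>a\<in>#S. real (gen_coeff n g a)) = (\<Sum>a\<in>#S. real_of_int ((t * a) mod int n))"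
    using gen_coeff_eq_mod[OF n g tg nz] by (intro arg_cong[of _ _ sum_mset] image_mset_cong) (metis of_int_of_nat_eq)
  also have "\<dots> = real_of_int (\<Sum>a\<in>#S. (t * a) mod int n)"
    by (induction S) auto
  finally have "g_norm n g S = 1" unfolding g_norm_def using sum n by simp
  then show ?thesis unfolding seq_index_def
    using g finite_generators[OF n] g_norm_ge_1[OF n _ S] by (intro Min_eqI) (auto intro: rev_image_eqI)
qed

section \<open>Normalisation of a singular sequence to \<open>(1)(-2)(c)(1 - c)\<close>\<close>

theorem theorem1:
  fixes n :: nat and x1 x2 x3 x4 :: int
  assumes "n \<ge> 1" and "gcd n 6 = 1"
    and "1 \<le> x1" "x1 < int n" and "1 \<le> x2" "x2 < int n"
    and "1 \<le> x3" "x3 < int n" and "1 \<le> x4" "x4 < int n"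
    and "minimal_zero_sum n {#x1, x2, x3, x4#}"
    and "x1 = 1"
    and "x2 + 1 = x3 \<or> x2 = int n - 2"
    and "gcd x1 (int n) = 1" "gcd x2 (int n) = 1" "gcd x3 (int n) = 1" "gcd x4 (int n) = 1"
  shows "seq_index n {#x1, x2, x3, x4#} = 1"
proof -
  let ?n = "int n"
  have n1: "?n > 1" using assms(3,4) by linarith
  have cop6: "coprime ?n 6"
    using assms(2) by (metis coprime_iff_gcd_eq_1 coprime_int_iff of_nat_numeral)
  have zs: "zero_sum n {#x1, x2, x3, x4#}" using assms by (simp add: minimal_zero_sum_def)
  then have dvd: "?n dvd 1 + x2 + x3 + x4"
    using \<open>x1 = 1\<close> by (simp add: zero_sum_def cong_0_iff add_ac)
  \<comment> \<open>Minimality applied to these two pairs excludes \<open>c = 2\<close> and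
    \<open>c = - 1\<close> in both cases below.\<close>
  have pair: "\<not> ?n dvd 1 + y" if "y = x3 \<or> y = x4" for y
  proof -
    have "{#1, y#} \<subset># {#x1, x2, x3, x4#}"
      using that \<open>x1 = 1\<close> by (auto simp: subset_mset_def add_mset_commute)
    then have "\<not> zero_sum n {#1, y#}" using assms(11) by (auto simp: minimal_zero_sum_def)
    then show ?thesis by (simp add: zero_sum_def cong_0_iff)
  qed
  have x: "coprime x2 ?n" "coprime x3 ?n" "coprime x4 ?n"
    using assms by (simp_all add: coprime_iff_gcd_eq_1)
  have unit_ndvd: "\<not> ?n dvd a" if "coprime a ?n" for a
    using that n1 coprime_common_divisor[of a ?n ?n] by auto
  have "\<exists>t. coprime t ?n \<and>
      (t * 1) mod ?n + (t * x2) mod ?n + (t * x3) mod ?n + (t * x4) mod ?n = ?n"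
    using assms(13)
  proof
    assume x23: "x2 + 1 = x3"
    \<comment> \<open>Multiplication by the inverse \<open>c\<close> of \<open>x3\<close> sends
      \<open>x1, x2, x3, x4\<close> to \<open>c, 1 - c, 1, - 2\<close>.\<close>
    obtain c where c: "[x3 * c = 1] (mod ?n)" using x by (auto simp: coprime_iff_invertible_int)
    have copc: "coprime c ?n" using c by (metis coprime_iff_invertible_int mult.commute)
    have "[c - 1 = - (c * x2)] (mod ?n)"
      using c x23 by (simp add: cong_iff_dvd_diff algebra_simps flip: x23)
    then have cop1: "coprime (c - 1) ?n"
      using copc x by (metis cong_imp_coprime cong_sym coprime_minus_left_iff coprime_mult_left_iff)
    have "1 + x2 + x3 + x4 = x4 - (- 2 * x3)" using x23 by simp
    then have x4: "[x4 = - 2 * x3] (mod ?n)" using dvd by (simp only: cong_iff_dvd_diff)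
    have "\<not> [c = 2] (mod ?n)"
    proof
      assume "[c = 2] (mod ?n)"
      then have "[x3 * 2 = 1] (mod ?n)" using c by (meson cong_scalar_left cong_sym cong_trans)
      then have "[1 + x4 = 1 + - 1] (mod ?n)"
        using x4 by (intro cong_add cong_refl) (metis cong_minus_minus_iff cong_trans mult.commute mult_minus_left)
      then show False using pair[of x4] by (simp add: cong_0_iff)
    qed
    moreover have "\<not> [c = - 1] (mod ?n)"
    proof
      assume "[c = - 1] (mod ?n)"
      then have "[x3 * - 1 = 1] (mod ?n)" using c by (meson cong_scalar_left cong_sym cong_trans)
      moreover have "x3 * - 1 - 1 = - (1 + x3)" by simp
      ultimately have "?n dvd 1 + x3" by (simp only: cong_iff_dvd_diff dvd_minus_iff)
      then show False using pair[of x3] by simp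
    qed
    ultimately obtain m where m: "coprime m ?n" "residue_sum ?n c m = ?n"
      using ex_residue_sum_eq[OF n1 cop6 copc cop1] by blast
    define t where "t = m * c"
    have t3: "[t * x3 = m] (mod ?n)"
      using cong_scalar_left[OF c, of m] by (simp add: t_def mult_ac)
    have "[t * x2 = m * (1 - c)] (mod ?n)"
      using cong_diff[OF t3 cong_refl[of t]] by (simp add: t_def algebra_simps flip: x23)
    moreover have "[t * x4 = - 2 * m] (mod ?n)"
      using cong_scalar_left[OF x4, of t] cong_scalar_left[OF t3, of "- 2"]
      by (simp add: mult_ac) (meson cong_trans)
    moreover have "coprime t ?n" using m copc by (simp add: t_def)
    ultimately show ?thesis using m t3
      by (intro exI[of _ t]) (simp add: cong_def residue_sum_def t_def)
  next
    assume x2: "x2 = ?n - 2"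
    \<comment> \<open>Here the sequence already has the normal form, with \<open>x3\<close> as
      \<open>c\<close>.\<close>
    have x4: "[x4 = 1 - x3] (mod ?n)"
      using dvd dvd_add_right_iff[of ?n ?n "x3 + x4 - 1"] x2
      by (simp add: cong_iff_dvd_diff algebra_simps)
    have "\<not> [x3 = 2] (mod ?n)"
    proof
      assume "[x3 = 2] (mod ?n)"
      then have "[1 + x4 = 1 + (1 - 2)] (mod ?n)"
        using x4 by (intro cong_add cong_refl) (meson cong_diff cong_refl cong_trans)
      then show False using pair[of x4] by (simp add: cong_0_iff)
    qed
    moreover have "\<not> [x3 = - 1] (mod ?n)"
      using pair[of x3] by (simp add: cong_iff_dvd_diff add.commute)
    moreover have "coprime (x3 - 1) ?n"
    proof -
      have "coprime (1 - x3) ?n" using x x4 cong_imp_coprime by blast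
      then show ?thesis by (metis coprime_minus_left_iff minus_diff_eq)
    qed
    ultimately obtain m where m: "coprime m ?n" "residue_sum ?n x3 m = ?n"
      using ex_residue_sum_eq[OF n1 cop6 x(2)] by blast
    have "[m * x2 = - 2 * m] (mod ?n)" by (simp add: x2 cong_iff_dvd_diff algebra_simps)
    moreover have "[m * x4 = m * (1 - x3)] (mod ?n)" using x4 by (rule cong_scalar_left)
    ultimately show ?thesis using m by (intro exI[of _ m]) (simp add: cong_def residue_sum_def)
  qed
  then obtain t where t: "coprime t ?n"
    "(t * 1) mod ?n + (t * x2) mod ?n + (t * x3) mod ?n + (t * x4) mod ?n = ?n" by blast
  show ?thesis
  proof (rule seq_index_eq_1I[OF assms(1) zs _ t(1)])
    show "\<not> ?n dvd t * a" if "a \<in># {#x1, x2, x3, x4#}" for a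
      using that t x \<open>x1 = 1\<close> by (intro unit_ndvd) auto
  qed (use t \<open>x1 = 1\<close> in \<open>simp_all add: add_ac\<close>)
qed

end
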